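(* Let $G=(V,E)$ be an orientation of a finite connected graph and let $p\geq2$ be an integer. Then the normal form of the flow polynomial of $G$ is $$[f_G^p]=p\cdot\sum_{\psi:E\to\{0,\dots,p-2\}}c(\psi)\prod_{e\in E}x_e^{\psi(e)},$$ where $c(\psi)$ denotes the number of even $\psi$-conformal dual $p$-flows on $G$ minus the number of odd $\psi$-conformal dual $p$-flows on $G$.
   Context: $\mathbb{Z}_p=\{0,\dots,p-1\}$ is the integers modulo $p$. $\delta^-(v)$ ($\delta^+(v)$) is the set of arcs with head (tail) $v$. The flow polynomial is $f_G^p:=\prod_{v\in V}\sum_{i=0}^{p-1}\Big(\prod_{e\in\delta^-(v)}x_e\prod_{e\in\delta^+(v)}x_e^{p-1}\Big)^i\in\mathbb{C}[x_e:e\in E]$. Let $I_E^p:=\mathrm{ideal}\{\sum_{i=0}^{p-1}x_e^i:e\in E\}$. Basic monomials are $\prod_{e}x_e^{\psi(e)}$ with $\psi:E\to\{0,\dots,p-2\}$; their classes form a $\mathbb{C}$-basis of $\mathbb{C}[x]/I_E^p$, and the normal form $[f]$ of $f$ is the unique $\mathbb{C}$-linear combination of basic monomials with $f-[f]\in I_E^p$. A dual $p$-flow is a map $\phi:E\to\mathbb{Z}_p$ such that for every circuit of the underlying graph, traversed in one direction, the signed sum of $\phi$ over its arcs ($+$ for arcs traversed forward, $-$ for arcs traversed backward) is $0$ in $\mathbb{Z}_p$. A map $\phi:E\to\mathbb{Z}_p$ is even if $|\phi^{-1}(p-1)|$ is even and odd otherwise. For $\psi:E\to\{0,\dots,p-2\}$,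 $\phi$ is $\psi$-conformal if $\phi(e)\in\{\psi(e),p-1\}$ for all $e$. *)

theory Defs
  imports
    Complex_Main
    "HOL-Library.Poly_Mapping"
    "HOL-Library.FuncSet"
    "HOL-Number_Theory.Cong"
    "Graph_Theory.Digraph_Component"
begin

text \<open>
  A polynomial over the complex numbers is a finitely supported map from exponent vectors
  to coefficients.  The index type of the variables may be larger than the arc set \<open>E\<close>
  (which may even be empty), so the ring of polynomials in the \<open>x\<^sub>e\<close> with \<open>e \<in> E\<close>
  is carved out as \<open>polys_in E\<close>.
\<close>

type_synonym 'e cpoly = "('e \<Rightarrow>\<^sub>0 nat) \<Rightarrow>\<^sub>0 complex"

definition pvar :: "'e \<Rightarrow> 'e cpoly" where
  "pvar e = Poly_Mapping.single (Poly_Mapping.single e 1) 1"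

definition pconst :: "complex \<Rightarrow> 'e cpoly" where
  "pconst c = Poly_Mapping.single 0 c"

definition polys_in :: "'e set \<Rightarrow> 'e cpoly set" where
  "polys_in E = {f. \<forall>m\<in>Poly_Mapping.keys f. Poly_Mapping.keys m \<subseteq> E}"

definition root_ideal :: "nat \<Rightarrow> 'e set \<Rightarrow> 'e cpoly set" where
  "root_ideal p E =
     {(\<Sum>e\<in>E. q e * (\<Sum>i=0..p-1. pvar e ^ i)) | q. \<forall>e\<in>E. q e \<in> polys_in E}"

definition basic_exponents :: "nat \<Rightarrow> 'e set \<Rightarrow> ('e \<Rightarrow> nat) set" where
  "basic_exponents p E = (E \<rightarrow>\<^sub>E {0..p-2})"

definition power_product :: "'e set \<Rightarrow> ('e \<Rightarrow> nat) \<Rightarrow> 'e cpoly" where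
  "power_product E \<psi> = (\<Prod>e\<in>E. pvar e ^ \<psi> e)"

definition basic_combinations :: "nat \<Rightarrow> 'e set \<Rightarrow> 'e cpoly set" where
  "basic_combinations p E =
     {(\<Sum>\<psi>\<in>basic_exponents p E. pconst (a \<psi>) * power_product E \<psi>) | a. True}"

definition normal_form :: "nat \<Rightarrow> 'e set \<Rightarrow> 'e cpoly \<Rightarrow> 'e cpoly" where
  "normal_form p E f = (THE g. g \<in> basic_combinations p E \<and> f - g \<in> root_ideal p E)"

definition flow_poly :: "nat \<Rightarrow> ('v, 'e) pre_digraph \<Rightarrow> 'e cpoly" where
  "flow_poly p G =
     (\<Prod>v\<in>verts G. \<Sum>i=0..p-1.
        ((\<Prod>e\<in>in_arcs G v. pvar e) * (\<Prod>e\<in>out_arcs G v. pvar e ^ (p - 1))) ^ i)"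

text \<open>
  Each arc \<open>e\<close> of \<open>G\<close> yields two arcs of \<open>two_way G\<close>: \<open>(e, True)\<close> is \<open>e\<close> traversed
  forward, \<open>(e, False)\<close> is \<open>e\<close> traversed backward.  A circuit of the underlying graph
  together with a direction of traversal is a cycle of \<open>two_way G\<close> using no arc of \<open>G\<close>
  twice.  Loops are circuits of length one, pairs of parallel or antiparallel arcs are
  circuits of length two.
\<close>

definition two_way :: "('v, 'e) pre_digraph \<Rightarrow> ('v, 'e \<times> bool) pre_digraph" where
  "two_way G =
     \<lparr>verts = verts G,
      arcs = arcs G \<times> UNIV,
      tail = (\<lambda>(e, fwd). if fwd then tail G e else head G e),
      head = (\<lambda>(e, fwd). if fwd then head G e else tail G e)\<rparr>"

definition traversed_circuit :: "('v, 'e) pre_digraph \<Rightarrow> ('e \<times> bool) list \<Rightarrow> bool" where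
  "traversed_circuit G c \<longleftrightarrow> pre_digraph.cycle (two_way G) c \<and> distinct (map fst c)"

definition dual_flow :: "nat \<Rightarrow> ('v, 'e) pre_digraph \<Rightarrow> ('e \<Rightarrow> nat) \<Rightarrow> bool" where
  "dual_flow p G \<phi> \<longleftrightarrow>
     \<phi> \<in> arcs G \<rightarrow>\<^sub>E {0..p-1} \<and>
     (\<forall>c. traversed_circuit G c \<longrightarrow>
        [(\<Sum>(e, fwd)\<leftarrow>c. if fwd then int (\<phi> e) else - int (\<phi> e)) = 0] (mod int p))"

definition even_map :: "nat \<Rightarrow> 'e set \<Rightarrow> ('e \<Rightarrow> nat) \<Rightarrow> bool" where
  "even_map p E \<phi> \<longleftrightarrow> even (card {e \<in> E. \<phi> e = p - 1})"

definition conformal :: "nat \<Rightarrow> 'e set \<Rightarrow> ('e \<Rightarrow> nat) \<Rightarrow> ('e \<Rightarrow> nat) \<Rightarrow> bool" where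
  "conformal p E \<psi> \<phi> \<longleftrightarrow> (\<forall>e\<in>E. \<phi> e \<in> {\<psi> e, p - 1})"

definition conformal_excess :: "nat \<Rightarrow> ('v, 'e) pre_digraph \<Rightarrow> ('e \<Rightarrow> nat) \<Rightarrow> int" where
  "conformal_excess p G \<psi> =
     int (card {\<phi>. dual_flow p G \<phi> \<and> conformal p (arcs G) \<psi> \<phi> \<and> even_map p (arcs G) \<phi>}) -
     int (card {\<phi>. dual_flow p G \<phi> \<and> conformal p (arcs G) \<psi> \<phi> \<and> \<not> even_map p (arcs G) \<phi>})"

end

theory Submission
  imports Defs
begin

text \<open>
  Rewriting \<open>x\<^sub>e ^ n\<close> with \<open>x\<^sub>e ^ p \<equiv> 1\<close> and \<open>x\<^sub>e ^ (p - 1) \<equiv> - (1 + \<dots> + x\<^sub>e ^ (p - 2))\<close>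
  gives the coefficients of the normal form of every polynomial as explicit linear functionals;
  these annihilate the ideal, which is why the normal form is unique.

  Expanding the product over the vertices turns the flow polynomial into a sum over all maps
  \<open>y : V \<rightarrow> \<int>\<^sub>p\<close>, in which \<open>x\<^sub>e\<close> has exponent \<open>y (head e) + (p - 1) * y (tail e)\<close>.  Modulo \<open>p\<close> this
  is the coboundary of \<open>y\<close>.  Coboundaries are exactly the dual flows, and as \<open>G\<close> is connected
  each of them comes from \<open>p\<close> maps \<open>y\<close>.  The coefficient of the basic monomial \<open>x ^ \<psi>\<close> in the
  normal form of \<open>x ^ \<phi>\<close> is \<open>\<plusminus>1\<close>, according to the parity of \<open>\<phi>\<close>, if \<open>\<phi>\<close> is
  \<open>\<psi>\<close>-conformal, and 0 otherwise.
\<close>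

section \<open>Closed walks in the underlying graph\<close>

lemma two_way_simps [simp]:
  "verts (two_way G) = verts G"
  "arcs (two_way G) = arcs G \<times> UNIV"
  "tail (two_way G) (e, b) = (if b then tail G e else head G e)"
  "head (two_way G) (e, b) = (if b then head G e else tail G e)"
  by (simp_all add: two_way_def)

definition reverse_walk :: "('e \<times> bool) list \<Rightarrow> ('e \<times> bool) list" where
  "reverse_walk c = rev (map (\<lambda>(e, b). (e, \<not> b)) c)"

lemma not_distinct_map_decomp:
  assumes "\<not> distinct (map f xs)"
  obtains as x bs y cs where "xs = as @ x # bs @ y # cs" and "f x = f y"
  using not_distinct_decomp[OF assms]
  by (auto simp: map_eq_append_conv append_eq_map_conv map_eq_Cons_conv Cons_eq_map_conv)

lemma (in wf_digraph) awalk_append_ex: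
  "awalk u (c @ d) v \<longleftrightarrow> (\<exists>w. awalk u c w \<and> awalk w d v)"
  by (metis awalk_append_iff awalk_appendI)

lemma (in wf_digraph) wf_two_way: "wf_digraph (two_way G)"
  by unfold_locales (auto split: if_splits)

context wf_digraph
begin

interpretation two_way: wf_digraph "two_way G"
  by (rule wf_two_way)

lemma awalk_reverse_walk:
  "two_way.awalk u c v \<Longrightarrow> two_way.awalk v (reverse_walk c) u"
proof (induction c arbitrary: u)
  case Nil
  then show ?case by (auto simp: two_way.awalk_Nil_iff reverse_walk_def)
next
  case (Cons a c)
  obtain e b where a: "a = (e, b)" by fastforce
  have "two_way.awalk v (reverse_walk c) (head (two_way G) a)"
    using Cons by (simp add: two_way.awalk_Cons_iff)
  moreover have "two_way.awalk (head (two_way G) a) [(e, \<not> b)] u"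
    using Cons.prems by (auto simp: two_way.awalk_simps a)
  ultimately show ?case
    by (auto simp: a reverse_walk_def two_way.awalk_append_ex simp del: two_way.awalk_append_iff)
qed

lemma connected_two_way_awalk:
  assumes "Digraph_Component.connected G" and "u \<in> verts G" and "v \<in> verts G"
  obtains c where "two_way.awalk u c v"
proof -
  interpret symmetric: pair_wf_digraph "mk_symmetric G" by (rule wellformed_mk_symmetric)
  have "u \<rightarrow>\<^sup>*\<^bsub>mk_symmetric G\<^esub> v"
    using assms by (auto simp: connected_def strongly_connected_def)
  then have "\<exists>c. two_way.awalk u c v"
  proof (induction rule: symmetric.reachable_induct)
    case base
    then show ?case by (auto intro: exI[of _ "[]"] simp: two_way.awalk_Nil_iff)
  next
    case (step x y)
    then obtain c where c: "two_way.awalk u c x" by blast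
    from step(2) obtain e where "e \<in> arcs G"
      and "(x, y) = (tail G e, head G e) \<or> (x, y) = (head G e, tail G e)"
      by (auto simp: parcs_mk_symmetric)
    then have "\<exists>b. two_way.awalk x [(e, b)] y"
      by (auto simp: two_way.awalk_simps)
    with c show ?case by (blast intro: two_way.awalk_appendI)
  qed
  with that show ?thesis by blast
qed

text \<open>
  An arc traversed twice in the same direction revisits its head, so if no vertex is revisited,
  a repeated arc is traversed in opposite directions.
\<close>
lemma closed_walk_cases [consumes 1, case_names Nil circuit subwalk backtrack]:
  assumes walk: "two_way.awalk u c u"
  obtains "c = []"
  | "traversed_circuit G c"
  | c1 c2 c3 w where "c = c1 @ c2 @ c3" and "c2 \<noteq> []" and "c1 @ c3 \<noteq> []"
      and "two_way.awalk u (c1 @ c3) u" and "two_way.awalk w c2 w"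
  | c1 e b c2 c3 w where "c = c1 @ (e, b) # c2 @ (e, \<not> b) # c3"
      and "two_way.awalk u (c1 @ c3) u" and "two_way.awalk w c2 w"
proof -
  consider "c = []" | "traversed_circuit G c"
    | (vertex) "\<not> distinct (map (head (two_way G)) c)"
    | (arc) "distinct (map (head (two_way G)) c)" "\<not> distinct (map fst c)"
    using walk two_way.awalk_verts_conv'[of u c u]
    unfolding traversed_circuit_def two_way.cycle_def by (force simp: two_way.awalk_def)
  then show thesis
  proof cases
    case vertex
    then obtain c1 a c2 b c3 where c: "c = (c1 @ [a]) @ (c2 @ [b]) @ c3"
      and ab: "head (two_way G) a = head (two_way G) b"
      by (rule not_distinct_map_decomp) auto
    from walk have "two_way.awalk u (c1 @ [a]) (head (two_way G) b)"
      "two_way.awalk (head (two_way G) b) (c2 @ [b]) (head (two_way G) b)"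
      "two_way.awalk (head (two_way G) b) c3 u"
      unfolding c two_way.awalk_append_ex by (auto simp: two_way.awalk_simps ab)
    then show thesis
      using that(3)[of "c1 @ [a]" "c2 @ [b]" c3] c by (blast intro: two_way.awalk_appendI)
  next
    case arc
    from arc(2) obtain c1 e b c2 b' c3 where c: "c = c1 @ (e, b) # c2 @ (e, b') # c3"
      by (rule not_distinct_map_decomp) auto
    have b': "b' = (\<not> b)" using arc(1) unfolding c by auto
    from walk obtain x y where "two_way.awalk u c1 x" "two_way.awalk y c2 y" "two_way.awalk x c3 u"
      unfolding c two_way.awalk_append_ex two_way.awalk_Cons_iff
      by (auto simp: b' split: if_splits)
    then show thesis
      using that(4) c b' by (blast intro: two_way.awalk_appendI)
  qed (use that(1,2) in blast)+
qed

lemma closed_walk_induct [consumes 1, case_names Nil circuit subwalk backtrack]: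
  assumes "two_way.awalk u c u"
    and P_Nil: "P []"
    and P_circuit: "\<And>c. traversed_circuit G c \<Longrightarrow> P c"
    and P_subwalk: "\<And>c1 c2 c3. P (c1 @ c3) \<Longrightarrow> P c2 \<Longrightarrow> P (c1 @ c2 @ c3)"
    and P_backtrack:
      "\<And>c1 e b c2 c3. P (c1 @ c3) \<Longrightarrow> P c2 \<Longrightarrow> P (c1 @ (e, b) # c2 @ (e, \<not> b) # c3)"
  shows "P c"
  using assms(1)
proof (induction "length c" arbitrary: u c rule: less_induct)
  case less
  note shorter = less.hyps
  from less.prems show ?case
  proof (cases rule: closed_walk_cases)
    case Nil
    then show ?thesis using P_Nil by simp
  next
    case circuit
    then show ?thesis by (rule P_circuit)
  next
    case (subwalk c1 c2 c3 w)
    then have "P (c1 @ c3)" and "P c2" by (auto intro!: shorter)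
    then show ?thesis unfolding subwalk(1) by (rule P_subwalk)
  next
    case (backtrack c1 e b c2 c3 w)
    then have "P (c1 @ c3)" and "P c2" by (auto intro!: shorter)
    then show ?thesis unfolding backtrack(1) by (rule P_backtrack)
  qed
qed

end

section \<open>Potentials\<close>

definition walk_sum :: "('e \<Rightarrow> 'a::ab_group_add) \<Rightarrow> ('e \<times> bool) list \<Rightarrow> 'a" where
  "walk_sum \<phi> c = (\<Sum>(e, fwd)\<leftarrow>c. if fwd then \<phi> e else - \<phi> e)"

lemma walk_sum_Nil [simp]: "walk_sum \<phi> [] = 0"
  and walk_sum_Cons [simp]: "walk_sum \<phi> ((e, b) # c) = (if b then \<phi> e else - \<phi> e) + walk_sum \<phi> c"
  and walk_sum_append [simp]: "walk_sum \<phi> (c @ d) = walk_sum \<phi> c + walk_sum \<phi> d"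
  by (simp_all add: walk_sum_def)

lemma walk_sum_reverse_walk: "walk_sum \<phi> (reverse_walk c) = - walk_sum \<phi> c"
  by (induction c) (auto simp: reverse_walk_def)

lemma walk_sum_cong:
  fixes \<phi> \<chi> :: "'e \<Rightarrow> int"
  assumes "\<And>e. e \<in> fst ` set c \<Longrightarrow> [\<phi> e = \<chi> e] (mod n)"
  shows "[walk_sum \<phi> c = walk_sum \<chi> c] (mod n)"
  using assms
proof (induction c)
  case (Cons a c)
  obtain e b where a: "a = (e, b)" by fastforce
  have "[(if b then \<phi> e else - \<phi> e) = (if b then \<chi> e else - \<chi> e)] (mod n)"
    using Cons.prems[of e] by (simp add: a cong_minus_minus_iff)
  moreover have "[walk_sum \<phi> c = walk_sum \<chi> c] (mod n)"
    using Cons by simp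
  ultimately show ?case by (simp add: a cong_add)
qed simp

definition potential ::
  "int \<Rightarrow> ('v, 'e) pre_digraph \<Rightarrow> ('e \<Rightarrow> int) \<Rightarrow> ('v \<Rightarrow> int) \<Rightarrow> bool" where
  "potential n G \<phi> y \<longleftrightarrow> (\<forall>e\<in>arcs G. [\<phi> e = y (head G e) - y (tail G e)] (mod n))"

context wf_digraph
begin

interpretation two_way: wf_digraph "two_way G"
  by (rule wf_two_way)

lemma walk_sum_difference:
  "two_way.awalk u c v \<Longrightarrow> walk_sum (\<lambda>e. y (head G e) - y (tail G e)) c = y v - y u"
  by (induction c arbitrary: u) (auto simp: two_way.awalk_simps)

lemma walk_sum_potential:
  assumes "potential n G \<phi> y" and "two_way.awalk u c v"
  shows "[walk_sum \<phi> c = y v - y u] (mod n)"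
proof -
  have "fst ` set c \<subseteq> arcs G"
    using assms(2) by (auto simp: two_way.awalk_def)
  then have "[walk_sum \<phi> c = walk_sum (\<lambda>e. y (head G e) - y (tail G e)) c] (mod n)"
    using assms(1) by (intro walk_sum_cong) (auto simp: potential_def)
  then show ?thesis by (simp add: walk_sum_difference[OF assms(2)])
qed

lemma walk_sum_closed_walk:
  assumes "\<And>c. traversed_circuit G c \<Longrightarrow> [walk_sum \<phi> c = 0] (mod n)"
    and "two_way.awalk u c u"
  shows "[walk_sum \<phi> c = 0] (mod n)"
  using assms(2)
proof (induction c rule: closed_walk_induct)
  case (subwalk c1 c2 c3)
  from cong_add[OF this] show ?case by (simp add: add_ac)
next
  case (backtrack c1 e b c2 c3)
  from cong_add[OF this] show ?case by (simp add: add_ac)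
qed (simp_all add: assms(1))

lemma ex_potential:
  assumes conn: "Digraph_Component.connected G"
    and circuits: "\<And>c. traversed_circuit G c \<Longrightarrow> [walk_sum \<phi> c = 0] (mod n)"
  obtains y where "potential n G \<phi> y"
proof -
  obtain r where r: "r \<in> verts G"
    using conn by (auto simp: connected_def strongly_connected_def)
  have "\<exists>c. two_way.awalk r c v" if "v \<in> verts G" for v
    using connected_two_way_awalk[OF conn r that] by metis
  then obtain c where c: "\<And>v. v \<in> verts G \<Longrightarrow> two_way.awalk r (c v) v" by metis
  have "[\<phi> e = walk_sum \<phi> (c (head G e)) - walk_sum \<phi> (c (tail G e))] (mod n)"
    if e: "e \<in> arcs G" for e
  proof -
    have "two_way.awalk (tail G e) [(e, True)] (head G e)"
      using e by (simp add: two_way.awalk_simps)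
    then have "two_way.awalk r (c (tail G e) @ [(e, True)] @ reverse_walk (c (head G e))) r"
      using c e awalk_reverse_walk
      by (blast intro: two_way.awalk_appendI tail_in_verts head_in_verts)
    from walk_sum_closed_walk[OF circuits this]
    have "[\<phi> e - (walk_sum \<phi> (c (head G e)) - walk_sum \<phi> (c (tail G e))) = 0] (mod n)"
      by (simp add: walk_sum_reverse_walk algebra_simps)
    then show ?thesis by (simp only: cong_diff_iff_cong_0)
  qed
  then show thesis by (intro that[of "\<lambda>v. walk_sum \<phi> (c v)"]) (simp add: potential_def)
qed

lemma potential_unique:
  assumes "Digraph_Component.connected G" and "u \<in> verts G" and "v \<in> verts G"
    and y: "potential n G \<phi> y" and z: "potential n G \<phi> z" and base: "[y u = z u] (mod n)"
  shows "[y v = z v] (mod n)"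
proof -
  obtain c where c: "two_way.awalk u c v" using assms(1-3) by (rule connected_two_way_awalk)
  have "[y v - y u = z v - z u] (mod n)"
    using walk_sum_potential[OF y c] walk_sum_potential[OF z c] by (metis cong_sym cong_trans)
  from cong_add[OF this base] show ?thesis by simp
qed

lemma potential_cong:
  assumes "potential n G \<phi> y" and "\<And>v. v \<in> verts G \<Longrightarrow> [z v = y v] (mod n)"
  shows "potential n G \<phi> z"
  unfolding potential_def
proof
  fix e assume e: "e \<in> arcs G"
  then have "[\<phi> e = y (head G e) - y (tail G e)] (mod n)"
    using assms(1) by (simp add: potential_def)
  moreover have "[z (head G e) - z (tail G e) = y (head G e) - y (tail G e)] (mod n)"
    using e by (intro cong_diff assms(2)) auto
  ultimately show "[\<phi> e = z (head G e) - z (tail G e)] (mod n)"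
    by (metis cong_sym cong_trans)
qed

lemma walk_sum_circuit_potential:
  assumes "potential n G \<phi> y" and "traversed_circuit G c"
  shows "[walk_sum \<phi> c = 0] (mod n)"
proof -
  obtain u where "two_way.awalk u c u"
    using assms(2) by (auto simp: traversed_circuit_def two_way.cycle_def)
  from walk_sum_potential[OF assms(1) this] show ?thesis by simp
qed

end

section \<open>Dual flows as coboundaries\<close>

definition residues_on :: "nat \<Rightarrow> 'a set \<Rightarrow> ('a \<Rightarrow> int) \<Rightarrow> 'a \<Rightarrow> nat" where
  "residues_on p A f = (\<lambda>a\<in>A. nat (f a mod int p))"

lemma residues_on_cong:
  "p > 0 \<Longrightarrow> a \<in> A \<Longrightarrow> [int (residues_on p A f a) = f a] (mod int p)"
  by (simp add: residues_on_def)

lemma residues_on_in_PiE: "p > 0 \<Longrightarrow> residues_on p A f \<in> A \<rightarrow>\<^sub>E {0..p-1}"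
  using pos_mod_bound[of "int p"] by (fastforce simp: residues_on_def nat_le_iff of_nat_diff)

lemma PiE_eqI_cong:
  assumes "p > 0" and "f \<in> A \<rightarrow>\<^sub>E {0..p-1}" and "g \<in> A \<rightarrow>\<^sub>E {0..p-1}"
    and "\<And>a. a \<in> A \<Longrightarrow> [int (f a) = int (g a)] (mod int p)"
  shows "f = g"
proof (rule PiE_ext[OF assms(2,3)])
  fix a assume a: "a \<in> A"
  have "f a < p" and "g a < p"
    using PiE_mem[OF assms(2) a] PiE_mem[OF assms(3) a] assms(1) by auto
  with assms(4)[OF a] show "f a = g a" by (simp add: cong_int_iff cong_def)
qed

definition coboundary :: "nat \<Rightarrow> ('v, 'e) pre_digraph \<Rightarrow> ('v \<Rightarrow> nat) \<Rightarrow> 'e \<Rightarrow> nat" where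
  "coboundary p G y = residues_on p (arcs G) (\<lambda>e. int (y (head G e)) - int (y (tail G e)))"

lemma coboundary_in_PiE: "p > 0 \<Longrightarrow> coboundary p G y \<in> arcs G \<rightarrow>\<^sub>E {0..p-1}"
  unfolding coboundary_def by (rule residues_on_in_PiE)

lemma potential_coboundary:
  "p > 0 \<Longrightarrow> potential (int p) G (\<lambda>e. int (coboundary p G y e)) (\<lambda>v. int (y v))"
  unfolding potential_def coboundary_def by (intro ballI residues_on_cong)

lemma coboundary_eq_iff_potential:
  assumes "p > 0" and "\<phi> \<in> arcs G \<rightarrow>\<^sub>E {0..p-1}"
  shows "coboundary p G y = \<phi> \<longleftrightarrow> potential (int p) G (\<lambda>e. int (\<phi> e)) (\<lambda>v. int (y v))"
proof
  assume "potential (int p) G (\<lambda>e. int (\<phi> e)) (\<lambda>v. int (y v))"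
  then have "[int (coboundary p G y e) = int (\<phi> e)] (mod int p)" if "e \<in> arcs G" for e
    using that residues_on_cong[OF assms(1) that] unfolding potential_def coboundary_def
    by (metis (no_types, lifting) cong_sym cong_trans)
  then show "coboundary p G y = \<phi>"
    using assms by (intro PiE_eqI_cong[of p _ "arcs G"] coboundary_in_PiE)
qed (use potential_coboundary[OF assms(1)] in blast)

lemma coboundary_eq_mod:
  assumes "p > 0" and "e \<in> arcs G"
  shows "coboundary p G y e = (y (head G e) + (p - 1) * y (tail G e)) mod p"
proof -
  have "int (y (head G e) + (p - 1) * y (tail G e)) =
      (int (y (head G e)) - int (y (tail G e))) + int p * int (y (tail G e))"
    using assms(1) by (simp add: of_nat_diff left_diff_distrib)
  then have "int (y (head G e) + (p - 1) * y (tail G e)) mod int p =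
      (int (y (head G e)) - int (y (tail G e))) mod int p"
    by (simp only: mod_mult_self2)
  then show ?thesis
    using assms(2)
    by (simp only: coboundary_def residues_on_def restrict_apply' nat_int zmod_int[symmetric])
qed

lemma dual_flow_iff_walk_sum:
  "dual_flow p G \<phi> \<longleftrightarrow> \<phi> \<in> arcs G \<rightarrow>\<^sub>E {0..p-1} \<and>
    (\<forall>c. traversed_circuit G c \<longrightarrow> [walk_sum (\<lambda>e. int (\<phi> e)) c = 0] (mod int p))"
  by (simp add: dual_flow_def walk_sum_def)

lemma finite_dual_flows: "finite (arcs G) \<Longrightarrow> finite {\<phi>. dual_flow p G \<phi>}"
  by (rule finite_subset[of _ "arcs G \<rightarrow>\<^sub>E {0..p-1}"]) (auto simp: dual_flow_def finite_PiE)

lemma (in wf_digraph) dual_flow_coboundary: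
  assumes "p > 0"
  shows "dual_flow p G (coboundary p G y)"
  using walk_sum_circuit_potential[OF potential_coboundary[OF assms]] coboundary_in_PiE[OF assms]
  by (simp add: dual_flow_iff_walk_sum)

lemma (in wf_digraph) dual_flow_ex_potential:
  assumes "Digraph_Component.connected G" and "dual_flow p G \<phi>"
  obtains y where "potential (int p) G (\<lambda>e. int (\<phi> e)) y"
proof (rule ex_potential[OF assms(1)])
  show "[walk_sum (\<lambda>e. int (\<phi> e)) c = 0] (mod int p)" if "traversed_circuit G c" for c
    using assms(2) that by (simp add: dual_flow_iff_walk_sum)
qed

lemma (in wf_digraph) bij_betw_coboundary_fiber:
  assumes conn: "Digraph_Component.connected G" and p: "p > 0" and \<phi>: "dual_flow p G \<phi>"
    and r: "r \<in> verts G"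
  shows "bij_betw (\<lambda>y. y r) {y \<in> verts G \<rightarrow>\<^sub>E {0..p-1}. coboundary p G y = \<phi>} {0..p-1}"
proof -
  let ?potential = "potential (int p) G (\<lambda>e. int (\<phi> e))"
  let ?F = "{y \<in> verts G \<rightarrow>\<^sub>E {0..p-1}. coboundary p G y = \<phi>}"
  have F: "?F = {y \<in> verts G \<rightarrow>\<^sub>E {0..p-1}. ?potential (\<lambda>v. int (y v))}"
    using \<phi> by (simp add: coboundary_eq_iff_potential[OF p] dual_flow_def)
  obtain z where z: "?potential z"
    using conn \<phi> by (rule dual_flow_ex_potential)
  have "inj_on (\<lambda>y. y r) ?F"
  proof (rule inj_onI)
    fix y y' assume y: "y \<in> ?F" and y': "y' \<in> ?F" and eq: "y r = y' r"
    have "?potential (\<lambda>v. int (y v))" and "?potential (\<lambda>v. int (y' v))"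
      using y y' unfolding F by simp_all
    then have "[int (y v) = int (y' v)] (mod int p)" if "v \<in> verts G" for v
      by (rule potential_unique[OF conn r that]) (simp add: eq)
    with y y' show "y = y'" by (intro PiE_eqI_cong[OF p, of y "verts G" y']) blast+
  qed
  moreover have "(\<lambda>y. y r) ` ?F = {0..p-1}"
  proof (intro equalityI subsetI)
    fix k assume k: "k \<in> {0..p-1}"
    let ?y = "residues_on p (verts G) (\<lambda>v. z v + (int k - z r))"
    have "?potential (\<lambda>v. z v + (int k - z r))"
      using z by (simp add: potential_def)
    then have "?potential (\<lambda>v. int (?y v))"
      by (rule potential_cong) (rule residues_on_cong[OF p])
    then have "?y \<in> ?F" unfolding F by (intro CollectI conjI residues_on_in_PiE[OF p])
    moreover have "k = ?y r" using r k p by (simp add: residues_on_def)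
    ultimately show "k \<in> (\<lambda>y. y r) ` ?F" by (intro rev_image_eqI[where x = ?y])
  qed (use r in auto)
  ultimately show ?thesis by (simp add: bij_betw_def)
qed

lemma (in wf_digraph) card_coboundary_fiber:
  assumes "Digraph_Component.connected G" and "p > 0" and "dual_flow p G \<phi>"
  shows "card {y \<in> verts G \<rightarrow>\<^sub>E {0..p-1}. coboundary p G y = \<phi>} = p"
proof -
  obtain r where "r \<in> verts G"
    using assms(1) by (auto simp: connected_def strongly_connected_def)
  from bij_betw_same_card[OF bij_betw_coboundary_fiber[OF assms this]]
  show ?thesis using assms(2) by simp
qed

lemma (in fin_digraph) sum_coboundary:
  fixes h :: "('b \<Rightarrow> nat) \<Rightarrow> 'c::comm_semiring_1"
  assumes "Digraph_Component.connected G" and "p > 0"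
  shows "(\<Sum>y\<in>verts G \<rightarrow>\<^sub>E {0..p-1}. h (coboundary p G y)) =
    of_nat p * (\<Sum>\<phi> | dual_flow p G \<phi>. h \<phi>)"
proof -
  let ?Y = "verts G \<rightarrow>\<^sub>E {0..p-1}"
  have "(\<Sum>y\<in>?Y. h (coboundary p G y)) =
      (\<Sum>\<phi> | dual_flow p G \<phi>. \<Sum>y\<in>{y \<in> ?Y. coboundary p G y = \<phi>}. h (coboundary p G y))"
    using dual_flow_coboundary[OF assms(2)]
    by (intro sum.group[symmetric]) (auto simp: finite_PiE finite_dual_flows)
  also have "\<dots> = (\<Sum>\<phi> | dual_flow p G \<phi>. of_nat p * h \<phi>)"
    using card_coboundary_fiber[OF assms] by (intro sum.cong) simp_all
  finally show ?thesis by (simp add: sum_distrib_left)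
qed

section \<open>Polynomials in the variables of a set\<close>

lemma pconst_0 [simp]: "pconst 0 = 0"
  and pconst_1 [simp]: "pconst 1 = 1"
  and pconst_uminus: "pconst (- c) = - pconst c"
  and pconst_of_nat: "pconst (of_nat n) = of_nat n"
  and pconst_of_int: "pconst (of_int k) = of_int k"
  and pconst_add: "pconst (c + d) = pconst c + pconst d"
  and pconst_mult: "pconst (c * d) = pconst c * pconst d"
  by (simp_all add: pconst_def single_uminus single_add mult_single)

lemma pconst_sum: "pconst (sum c A) = (\<Sum>x\<in>A. pconst (c x))"
  by (induction A rule: infinite_finite_induct) (simp_all add: pconst_add)

lemma pconst_prod: "pconst (prod c A) = (\<Prod>x\<in>A. pconst (c x))"
  by (induction A rule: infinite_finite_induct) (simp_all add: pconst_mult)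

lemma poly_mapping_sum_single:
  "f = (\<Sum>m\<in>Poly_Mapping.keys f. Poly_Mapping.single m (Poly_Mapping.lookup f m))"
  by (rule poly_mapping_eqI) (simp add: lookup_sum lookup_single when_def in_keys_iff)

lemma pvar_power: "pvar e ^ n = Poly_Mapping.single (Poly_Mapping.single e n) 1"
  by (induction n) (simp_all add: pvar_def mult_single flip: single_add)

lemma power_product_eq_single:
  "finite E \<Longrightarrow> power_product E n =
    Poly_Mapping.single (\<Sum>e\<in>E. Poly_Mapping.single e (n e)) 1"
  by (induction E rule: finite_induct) (simp_all add: power_product_def pvar_power mult_single)

lemma polys_in_sum_power_product:
  assumes "finite E" and "f \<in> polys_in E"
  shows "f = (\<Sum>m\<in>Poly_Mapping.keys f.
    pconst (Poly_Mapping.lookup f m) * power_product E (Poly_Mapping.lookup m))"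
proof -
  have "power_product E (Poly_Mapping.lookup m) = Poly_Mapping.single m 1"
    if "m \<in> Poly_Mapping.keys f" for m
  proof -
    have "Poly_Mapping.keys m \<subseteq> E" using assms(2) that by (simp add: polys_in_def)
    then have "m = (\<Sum>e\<in>E. Poly_Mapping.single e (Poly_Mapping.lookup m e))"
      using assms(1)
      by (intro poly_mapping_eqI) (auto simp: lookup_sum lookup_single when_def in_keys_iff)
    then show ?thesis using assms(1) by (simp add: power_product_eq_single)
  qed
  then show ?thesis
    by (subst poly_mapping_sum_single) (simp add: pconst_def mult_single)
qed

lemma polys_in_pconst [simp]: "pconst c \<in> polys_in E"
  by (simp add: polys_in_def pconst_def)

lemma polys_in_0 [simp]: "0 \<in> polys_in E"
  and polys_in_1 [simp]: "1 \<in> polys_in E"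
  using polys_in_pconst[of 0 E] polys_in_pconst[of 1 E] by simp_all

lemma polys_in_pvar: "e \<in> E \<Longrightarrow> pvar e \<in> polys_in E"
  by (simp add: polys_in_def pvar_def)

lemma polys_in_add: "f \<in> polys_in E \<Longrightarrow> g \<in> polys_in E \<Longrightarrow> f + g \<in> polys_in E"
  using keys_add[of f g] by (fastforce simp: polys_in_def)

lemma polys_in_diff: "f \<in> polys_in E \<Longrightarrow> g \<in> polys_in E \<Longrightarrow> f - g \<in> polys_in E"
  using keys_diff[of f g] by (fastforce simp: polys_in_def)

lemma polys_in_mult:
  assumes "f \<in> polys_in E" and "g \<in> polys_in E"
  shows "f * g \<in> polys_in E"
  unfolding polys_in_def
proof (intro CollectI ballI)
  fix m assume "m \<in> Poly_Mapping.keys (f * g)"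
  then obtain a b where "m = a + b" "a \<in> Poly_Mapping.keys f" "b \<in> Poly_Mapping.keys g"
    using keys_mult[of f g] by blast
  then show "Poly_Mapping.keys m \<subseteq> E"
    using assms keys_add[of a b] by (fastforce simp: polys_in_def)
qed

lemma polys_in_power: "f \<in> polys_in E \<Longrightarrow> f ^ n \<in> polys_in E"
  by (induction n) (auto intro: polys_in_mult)

lemma polys_in_sum: "(\<And>x. x \<in> A \<Longrightarrow> f x \<in> polys_in E) \<Longrightarrow> sum f A \<in> polys_in E"
  by (induction A rule: infinite_finite_induct) (auto intro: polys_in_add)

lemma polys_in_prod: "(\<And>x. x \<in> A \<Longrightarrow> f x \<in> polys_in E) \<Longrightarrow> prod f A \<in> polys_in E"
  by (induction A rule: infinite_finite_induct) (auto intro: polys_in_mult)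

lemma polys_in_power_product: "power_product E n \<in> polys_in E"
  unfolding power_product_def by (intro polys_in_prod polys_in_power polys_in_pvar)

section \<open>Congruence modulo the root ideal\<close>

definition geometric_sum :: "nat \<Rightarrow> 'e \<Rightarrow> 'e cpoly" where
  "geometric_sum p e = (\<Sum>i=0..p-1. pvar e ^ i)"

lemma root_idealI:
  "q \<in> E \<rightarrow> polys_in E \<Longrightarrow> f = (\<Sum>e\<in>E. q e * geometric_sum p e) \<Longrightarrow> f \<in> root_ideal p E"
  by (auto simp: root_ideal_def geometric_sum_def)

lemma root_idealE:
  assumes "f \<in> root_ideal p E"
  obtains q where "q \<in> E \<rightarrow> polys_in E" and "f = (\<Sum>e\<in>E. q e * geometric_sum p e)"
  using assms by (auto simp: root_ideal_def geometric_sum_def)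

lemma root_ideal_0: "0 \<in> root_ideal p E"
  by (rule root_idealI[of "\<lambda>_. 0"]) simp_all

lemma root_ideal_add:
  assumes "f \<in> root_ideal p E" and "g \<in> root_ideal p E"
  shows "f + g \<in> root_ideal p E"
proof -
  obtain q where q: "q \<in> E \<rightarrow> polys_in E" "f = (\<Sum>e\<in>E. q e * geometric_sum p e)"
    using assms(1) by (rule root_idealE)
  obtain r where r: "r \<in> E \<rightarrow> polys_in E" "g = (\<Sum>e\<in>E. r e * geometric_sum p e)"
    using assms(2) by (rule root_idealE)
  show ?thesis
    using q r by (intro root_idealI[of "\<lambda>e. q e + r e"])
      (auto simp: distrib_right sum.distrib intro: polys_in_add)
qed

lemma root_ideal_mult:
  assumes "h \<in> polys_in E" and "f \<in> root_ideal p E"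
  shows "h * f \<in> root_ideal p E"
proof -
  obtain q where q: "q \<in> E \<rightarrow> polys_in E" "f = (\<Sum>e\<in>E. q e * geometric_sum p e)"
    using assms(2) by (rule root_idealE)
  then show ?thesis
    using assms(1) by (intro root_idealI[of "\<lambda>e. h * q e"])
      (auto simp: sum_distrib_left mult.assoc intro: polys_in_mult)
qed

lemma geometric_sum_in_root_ideal:
  assumes "finite E" and "e \<in> E"
  shows "geometric_sum p e \<in> root_ideal p E"
  using assms by (intro root_idealI[of "\<lambda>d. if d = e then 1 else 0"])
    (simp_all add: if_distrib[of "\<lambda>x. x * _"] cong: if_cong)

definition root_cong :: "nat \<Rightarrow> 'e set \<Rightarrow> 'e cpoly \<Rightarrow> 'e cpoly \<Rightarrow> bool" where
  "root_cong p E f g \<longleftrightarrow> f - g \<in> root_ideal p E"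

lemma root_cong_refl [simp]: "root_cong p E f f"
  by (simp add: root_cong_def root_ideal_0)

lemma root_cong_trans [trans]:
  "root_cong p E f g \<Longrightarrow> root_cong p E g h \<Longrightarrow> root_cong p E f h"
  unfolding root_cong_def using root_ideal_add by fastforce

lemma root_cong_add:
  "root_cong p E f f' \<Longrightarrow> root_cong p E g g' \<Longrightarrow> root_cong p E (f + g) (f' + g')"
  unfolding root_cong_def using root_ideal_add by (fastforce simp: algebra_simps)

lemma root_cong_mult:
  assumes "root_cong p E f f'" and "root_cong p E g g'" and "f \<in> polys_in E" and "g' \<in> polys_in E"
  shows "root_cong p E (f * g) (f' * g')"
proof -
  have "f * g - f' * g' = f * (g - g') + g' * (f - f')"
    by (simp add: algebra_simps)
  with assms show ?thesis
    unfolding root_cong_def by (metis root_ideal_add root_ideal_mult)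
qed

lemma root_cong_sum:
  "(\<And>x. x \<in> A \<Longrightarrow> root_cong p E (f x) (g x)) \<Longrightarrow> root_cong p E (sum f A) (sum g A)"
  by (induction A rule: infinite_finite_induct) (auto intro: root_cong_add)

lemma root_cong_prod:
  assumes "\<And>x. x \<in> A \<Longrightarrow> root_cong p E (f x) (g x)"
    and "\<And>x. x \<in> A \<Longrightarrow> f x \<in> polys_in E" and "\<And>x. x \<in> A \<Longrightarrow> g x \<in> polys_in E"
  shows "root_cong p E (prod f A) (prod g A)"
  using assms
  by (induction A rule: infinite_finite_induct) (auto intro!: root_cong_mult polys_in_prod)

lemma root_cong_power:
  "root_cong p E f g \<Longrightarrow> f \<in> polys_in E \<Longrightarrow> g \<in> polys_in E \<Longrightarrow> root_cong p E (f ^ n) (g ^ n)"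
  using root_cong_prod[of "{..<n}" p E "\<lambda>_. f" "\<lambda>_. g"] by simp

lemma pvar_power_p_cong:
  assumes "finite E" and "e \<in> E" and "p > 0"
  shows "root_cong p E (pvar e ^ p) 1"
proof -
  have "{..<p} = {0..p-1}" using assms(3) by auto
  then have "pvar e ^ p - 1 = (pvar e - 1) * geometric_sum p e"
    by (simp add: power_diff_1_eq geometric_sum_def)
  moreover have "pvar e - 1 \<in> polys_in E"
    using assms(2) by (intro polys_in_diff polys_in_pvar polys_in_1)
  ultimately show ?thesis
    unfolding root_cong_def using assms(1,2)
    by (simp add: root_ideal_mult geometric_sum_in_root_ideal)
qed

lemma pvar_power_mod_cong:
  assumes "finite E" and "e \<in> E" and "p > 0"
  shows "root_cong p E (pvar e ^ n) (pvar e ^ (n mod p))"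
proof -
  have "root_cong p E ((pvar e ^ p) ^ (n div p)) (1 ^ (n div p))"
    using assms by (intro root_cong_power pvar_power_p_cong polys_in_power polys_in_pvar) auto
  then have "root_cong p E ((pvar e ^ p) ^ (n div p) * pvar e ^ (n mod p)) (1 * pvar e ^ (n mod p))"
    using assms(2) by (intro root_cong_mult) (auto simp: polys_in_power polys_in_pvar)
  then show ?thesis by (simp flip: power_mult power_add)
qed

section \<open>Coefficients of normal forms\<close>

text \<open>The coefficient of \<open>x ^ i\<close>, for \<open>i < p - 1\<close>, in the normal form of \<open>x ^ n\<close>.\<close>
definition power_nf_coeff :: "nat \<Rightarrow> nat \<Rightarrow> nat \<Rightarrow> complex" where
  "power_nf_coeff p n i = (if n mod p = p - 1 then - 1 else if n mod p = i then 1 else 0)"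

definition monomial_nf_coeff :: "nat \<Rightarrow> 'e set \<Rightarrow> ('e \<Rightarrow> nat) \<Rightarrow> ('e \<Rightarrow> nat) \<Rightarrow> complex" where
  "monomial_nf_coeff p E n \<psi> = (\<Prod>e\<in>E. power_nf_coeff p (n e) (\<psi> e))"

definition nf_coeff :: "nat \<Rightarrow> 'e set \<Rightarrow> 'e cpoly \<Rightarrow> ('e \<Rightarrow> nat) \<Rightarrow> complex" where
  "nf_coeff p E f \<psi> = (\<Sum>m\<in>Poly_Mapping.keys f.
     Poly_Mapping.lookup f m * monomial_nf_coeff p E (Poly_Mapping.lookup m) \<psi>)"

definition basic_combination :: "nat \<Rightarrow> 'e set \<Rightarrow> (('e \<Rightarrow> nat) \<Rightarrow> complex) \<Rightarrow> 'e cpoly" where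
  "basic_combination p E a = (\<Sum>\<psi>\<in>basic_exponents p E. pconst (a \<psi>) * power_product E \<psi>)"

lemma basic_combinations_eq_range: "basic_combinations p E = range (basic_combination p E)"
  by (auto simp: basic_combinations_def basic_combination_def)

lemma basic_combination_cong:
  "(\<And>\<psi>. \<psi> \<in> basic_exponents p E \<Longrightarrow> a \<psi> = b \<psi>) \<Longrightarrow>
    basic_combination p E a = basic_combination p E b"
  by (simp add: basic_combination_def)

lemma finite_basic_exponents: "finite E \<Longrightarrow> finite (basic_exponents p E)"
  by (simp add: basic_exponents_def finite_PiE)

lemma basic_exponents_le: "\<psi> \<in> basic_exponents p E \<Longrightarrow> e \<in> E \<Longrightarrow> \<psi> e \<le> p - 2"
  by (auto simp: basic_exponents_def dest: PiE_mem)

lemma monomial_nf_coeff_cong_mod: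
  "(\<And>e. e \<in> E \<Longrightarrow> [m e = n e] (mod p)) \<Longrightarrow> monomial_nf_coeff p E m \<psi> = monomial_nf_coeff p E n \<psi>"
  unfolding monomial_nf_coeff_def power_nf_coeff_def cong_def by (intro prod.cong) simp_all

lemma nf_coeff_add: "nf_coeff p E (f + g) \<psi> = nf_coeff p E f \<psi> + nf_coeff p E g \<psi>"
  unfolding nf_coeff_def by (rule setsum_keys_plus_distrib) (simp_all add: distrib_right)

lemma nf_coeff_sum: "nf_coeff p E (sum f A) \<psi> = (\<Sum>x\<in>A. nf_coeff p E (f x) \<psi>)"
  by (induction A rule: infinite_finite_induct)
    (simp_all add: nf_coeff_add, simp_all add: nf_coeff_def)

lemma nf_coeff_single:
  "nf_coeff p E (Poly_Mapping.single m c) \<psi> =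
    c * monomial_nf_coeff p E (Poly_Mapping.lookup m) \<psi>"
  by (simp add: nf_coeff_def)

lemma nf_coeff_power_product:
  assumes "finite E"
  shows "nf_coeff p E (pconst c * power_product E n) \<psi> = c * monomial_nf_coeff p E n \<psi>"
proof -
  have "Poly_Mapping.lookup (\<Sum>d\<in>E. Poly_Mapping.single d (n d)) e = n e" if "e \<in> E" for e
    using assms that by (simp add: lookup_sum lookup_single when_def)
  then show ?thesis
    using assms
    by (simp add: power_product_eq_single pconst_def mult_single nf_coeff_single
        monomial_nf_coeff_def)
qed

lemma monomial_nf_coeff_basic:
  assumes "finite E" and "p \<ge> 2" and "\<psi> \<in> basic_exponents p E" and "\<psi>' \<in> basic_exponents p E"
  shows "monomial_nf_coeff p E \<psi>' \<psi> = (if \<psi>' = \<psi> then 1 else 0)"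
proof -
  have "power_nf_coeff p (\<psi>' e) (\<psi> e) = (if \<psi>' e = \<psi> e then 1 else 0)" if "e \<in> E" for e
    using basic_exponents_le[OF assms(4) that] assms(2) by (simp add: power_nf_coeff_def)
  moreover have "\<psi>' = \<psi> \<longleftrightarrow> (\<forall>e\<in>E. \<psi>' e = \<psi> e)"
    using assms(3,4) by (auto simp: basic_exponents_def intro: PiE_ext)
  ultimately show ?thesis
    using assms(1) by (auto simp: monomial_nf_coeff_def prod_zero_iff)
qed

lemma nf_coeff_basic_combination:
  assumes "finite E" and "p \<ge> 2" and "\<psi> \<in> basic_exponents p E"
  shows "nf_coeff p E (basic_combination p E a) \<psi> = a \<psi>"
  using assms
  by (simp add: basic_combination_def nf_coeff_sum nf_coeff_power_product monomial_nf_coeff_basic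
      finite_basic_exponents if_distrib[of "\<lambda>x. _ * x"] cong: if_cong)

lemma sum_periodic_shift:
  fixes g :: "nat \<Rightarrow> 'a::ab_group_add"
  assumes "\<And>k. g (k + p) = g k"
  shows "(\<Sum>k<p. g (n + k)) = (\<Sum>k<p. g k)"
proof (induction n)
  case (Suc n)
  have "g n + (\<Sum>k<p. g (Suc n + k)) = (\<Sum>k<Suc p. g (n + k))"
    by (simp add: sum.lessThan_Suc_shift del: sum.lessThan_Suc)
  also have "\<dots> = g n + (\<Sum>k<p. g (n + k))"
    by (simp add: assms add.commute)
  finally show ?case using Suc by simp
qed simp

lemma sum_power_nf_coeff:
  assumes "p \<ge> 2" and "i \<le> p - 2"
  shows "(\<Sum>k=0..p-1. power_nf_coeff p (n + k) i) = 0"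
proof -
  have p: "{0..p-1} = {..<p}" "{..<p} = insert (p - 1) {..<p-1}" using assms(1) by auto
  have "(\<Sum>k<p. power_nf_coeff p (n + k) i) = (\<Sum>k<p. power_nf_coeff p k i)"
    by (rule sum_periodic_shift) (simp add: power_nf_coeff_def)
  also have "\<dots> = - 1 + (\<Sum>k<p-1. power_nf_coeff p k i)"
    unfolding p(2) using assms(1) by (simp add: power_nf_coeff_def)
  also have "(\<Sum>k<p-1. power_nf_coeff p k i) = (\<Sum>k<p-1. if k = i then 1 else 0)"
    by (intro sum.cong) (auto simp: power_nf_coeff_def)
  also have "\<dots> = 1" using assms by simp
  finally show ?thesis unfolding p(1) by simp
qed

lemma monomial_nf_coeff_fun_upd:
  assumes "finite E" and "e \<in> E"
  shows "monomial_nf_coeff p E (n(e := k)) \<psi> =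
    power_nf_coeff p k (\<psi> e) * monomial_nf_coeff p (E - {e}) n \<psi>"
  using assms by (simp add: monomial_nf_coeff_def prod.remove cong: prod.cong_simp)

lemma nf_coeff_root_ideal:
  assumes "finite E" and "p \<ge> 2" and "\<psi> \<in> basic_exponents p E" and "f \<in> root_ideal p E"
  shows "nf_coeff p E f \<psi> = 0"
proof -
  have monomial: "nf_coeff p E (Poly_Mapping.single m c * geometric_sum p e) \<psi> = 0"
    if e: "e \<in> E" for m c e
  proof -
    let ?n = "Poly_Mapping.lookup m"
    have "Poly_Mapping.lookup (m + Poly_Mapping.single e i) = ?n(e := ?n e + i)" for i
      by (auto simp: lookup_add lookup_single when_def)
    then have "monomial_nf_coeff p E (Poly_Mapping.lookup (m + Poly_Mapping.single e i)) \<psi> =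
        power_nf_coeff p (?n e + i) (\<psi> e) * monomial_nf_coeff p (E - {e}) ?n \<psi>" for i
      using assms(1) e by (simp add: monomial_nf_coeff_fun_upd)
    then have "nf_coeff p E (Poly_Mapping.single m c * geometric_sum p e) \<psi> =
        c * (\<Sum>i=0..p-1. power_nf_coeff p (?n e + i) (\<psi> e)) * monomial_nf_coeff p (E - {e}) ?n \<psi>"
      by (simp add: geometric_sum_def pvar_power mult_single nf_coeff_sum nf_coeff_single
          sum_distrib_left sum_distrib_right mult.assoc)
    then show ?thesis
      by (simp only: sum_power_nf_coeff[OF assms(2) basic_exponents_le[OF assms(3) e]]) simp
  qed
  have "nf_coeff p E (q * geometric_sum p e) \<psi> = 0" if "e \<in> E" for q e
    by (subst poly_mapping_sum_single[of q])
      (simp add: sum_distrib_right nf_coeff_sum monomial[OF that])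
  then show ?thesis
    using assms(4) by (auto elim: root_idealE simp: nf_coeff_sum)
qed

section \<open>Existence and uniqueness of normal forms\<close>

lemma pvar_power_nf_cong:
  assumes "finite E" and "e \<in> E" and "p \<ge> 2"
  shows "root_cong p E (pvar e ^ n) (\<Sum>i=0..p-2. pconst (power_nf_coeff p n i) * pvar e ^ i)"
proof -
  have "root_cong p E (pvar e ^ n) (pvar e ^ (n mod p))"
    using assms by (intro pvar_power_mod_cong) auto
  also have "root_cong p E \<dots> (\<Sum>i=0..p-2. pconst (power_nf_coeff p n i) * pvar e ^ i)"
  proof (cases "n mod p = p - 1")
    case True
    have "{0..p-1} = insert (p - 1) {0..p-2}" using assms(3) by auto
    then have "geometric_sum p e = pvar e ^ (p - 1) + (\<Sum>i=0..p-2. pvar e ^ i)"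
      using assms(3) by (simp add: geometric_sum_def)
    then have "pvar e ^ (n mod p) - (\<Sum>i=0..p-2. pconst (power_nf_coeff p n i) * pvar e ^ i) =
        geometric_sum p e"
      using True by (simp add: power_nf_coeff_def pconst_uminus sum_negf)
    then show ?thesis
      unfolding root_cong_def using assms(1,2) by (simp add: geometric_sum_in_root_ideal)
  next
    case False
    moreover have "n mod p < p" using assms(3) by simp
    ultimately have "n mod p \<in> {0..p-2}" by auto
    with False show ?thesis
      by (simp add: power_nf_coeff_def if_distrib[of pconst] if_distrib[of "\<lambda>x. x * _"]
          cong: if_cong)
  qed
  finally show ?thesis .
qed

lemma power_product_nf_cong:
  assumes "finite E" and "p \<ge> 2"
  shows "root_cong p E (power_product E n) (basic_combination p E (monomial_nf_coeff p E n))"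
proof -
  have "root_cong p E (power_product E n)
      (\<Prod>e\<in>E. \<Sum>i=0..p-2. pconst (power_nf_coeff p (n e) i) * pvar e ^ i)"
    unfolding power_product_def using assms
    by (intro root_cong_prod pvar_power_nf_cong polys_in_sum polys_in_mult polys_in_power
        polys_in_pvar polys_in_pconst)
  also have "(\<Prod>e\<in>E. \<Sum>i=0..p-2. pconst (power_nf_coeff p (n e) i) * pvar e ^ i) =
      (\<Sum>\<psi>\<in>basic_exponents p E. \<Prod>e\<in>E. pconst (power_nf_coeff p (n e) (\<psi> e)) * pvar e ^ \<psi> e)"
    unfolding basic_exponents_def using assms(1) by (subst prod_sum_PiE) simp_all
  finally show ?thesis
    by (simp add: basic_combination_def monomial_nf_coeff_def pconst_prod prod.distrib
        power_product_def)
qed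

lemma polys_in_nf_cong:
  assumes "finite E" and "p \<ge> 2" and "f \<in> polys_in E"
  shows "root_cong p E f (basic_combination p E (nf_coeff p E f))"
proof -
  let ?c = "Poly_Mapping.lookup f" and ?K = "Poly_Mapping.keys f"
  let ?nf = "\<lambda>m. basic_combination p E (monomial_nf_coeff p E (Poly_Mapping.lookup m))"
  have "root_cong p E (\<Sum>m\<in>?K. pconst (?c m) * power_product E (Poly_Mapping.lookup m))
      (\<Sum>m\<in>?K. pconst (?c m) * ?nf m)"
    using assms(1,2)
    by (intro root_cong_sum root_cong_mult power_product_nf_cong)
      (auto simp: basic_combination_def intro!: polys_in_sum polys_in_mult polys_in_power_product)
  then have "root_cong p E f (\<Sum>m\<in>?K. pconst (?c m) * ?nf m)"
    using polys_in_sum_power_product[OF assms(1,3)] by simp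
  also have "(\<Sum>m\<in>?K. pconst (?c m) * ?nf m) = basic_combination p E (nf_coeff p E f)"
    unfolding basic_combination_def nf_coeff_def sum_distrib_left
    by (subst sum.swap) (simp add: pconst_sum pconst_mult sum_distrib_right mult.assoc)
  finally show ?thesis .
qed

theorem normal_form_eq:
  assumes "finite E" and "p \<ge> 2" and "f \<in> polys_in E"
  shows "normal_form p E f = basic_combination p E (nf_coeff p E f)"
  unfolding normal_form_def
proof (rule the_equality)
  show "basic_combination p E (nf_coeff p E f) \<in> basic_combinations p E \<and>
      f - basic_combination p E (nf_coeff p E f) \<in> root_ideal p E"
    using polys_in_nf_cong[OF assms] by (auto simp: basic_combinations_eq_range root_cong_def)
next
  fix g assume "g \<in> basic_combinations p E \<and> f - g \<in> root_ideal p E"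
  then obtain a where g: "g = basic_combination p E a" and ideal: "f - g \<in> root_ideal p E"
    by (auto simp: basic_combinations_eq_range)
  have "a \<psi> = nf_coeff p E f \<psi>" if "\<psi> \<in> basic_exponents p E" for \<psi>
  proof -
    have "nf_coeff p E f \<psi> = nf_coeff p E (f - g) \<psi> + nf_coeff p E g \<psi>"
      by (simp flip: nf_coeff_add)
    also have "\<dots> = a \<psi>"
      using nf_coeff_root_ideal[OF assms(1,2) that ideal]
        nf_coeff_basic_combination[OF assms(1,2) that]
      by (simp add: g)
    finally show ?thesis by simp
  qed
  then show "g = basic_combination p E (nf_coeff p E f)"
    unfolding g by (rule basic_combination_cong)
qed

section \<open>The normal form of the flow polynomial\<close>

lemma prod_fibers:
  fixes h :: "'a \<Rightarrow> 'b \<Rightarrow> 'c::comm_monoid_mult"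
  assumes "finite A" and "finite B" and "f ` A \<subseteq> B"
  shows "(\<Prod>b\<in>B. \<Prod>a\<in>{a \<in> A. f a = b}. h a b) = (\<Prod>a\<in>A. h a (f a))"
proof -
  have "(\<Prod>b\<in>B. \<Prod>a\<in>{a \<in> A. f a = b}. h a b) = (\<Prod>b\<in>B. \<Prod>a\<in>{a \<in> A. f a = b}. h a (f a))"
    by (intro prod.cong) auto
  also have "\<dots> = (\<Prod>a\<in>A. h a (f a))"
    using assms by (rule prod.group)
  finally show ?thesis .
qed

lemma (in fin_digraph) flow_poly_expand:
  "flow_poly p G = (\<Sum>y\<in>verts G \<rightarrow>\<^sub>E {0..p-1}.
     power_product (arcs G) (\<lambda>e. y (head G e) + (p - 1) * y (tail G e)))"
proof -
  have "(\<Prod>v\<in>verts G. ((\<Prod>e\<in>in_arcs G v. pvar e) * (\<Prod>e\<in>out_arcs G v. pvar e ^ (p - 1))) ^ y v) =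
      power_product (arcs G) (\<lambda>e. y (head G e) + (p - 1) * y (tail G e))" for y :: "_ \<Rightarrow> nat"
  proof -
    have "(\<Prod>v\<in>verts G. \<Prod>e\<in>in_arcs G v. pvar e ^ y v) = (\<Prod>e\<in>arcs G. pvar e ^ y (head G e))"
      unfolding in_arcs_def by (rule prod_fibers) auto
    moreover have "(\<Prod>v\<in>verts G. \<Prod>e\<in>out_arcs G v. pvar e ^ ((p - 1) * y v)) =
        (\<Prod>e\<in>arcs G. pvar e ^ ((p - 1) * y (tail G e)))"
      unfolding out_arcs_def by (rule prod_fibers) auto
    ultimately show ?thesis
      by (simp add: power_mult_distrib prod_power_distrib prod.distrib power_product_def power_add
          flip: power_mult)
  qed
  then show ?thesis
    unfolding flow_poly_def by (subst prod_sum_PiE) simp_all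
qed

lemma monomial_nf_coeff_conformal:
  assumes "finite E" and "p > 0" and "\<phi> \<in> E \<rightarrow>\<^sub>E {0..p-1}"
  shows "monomial_nf_coeff p E \<phi> \<psi> =
    (if conformal p E \<psi> \<phi> then if even_map p E \<phi> then 1 else - 1 else 0)"
proof -
  have coeff: "power_nf_coeff p (\<phi> e) (\<psi> e) =
      (if \<phi> e = p - 1 then - 1 else if \<phi> e = \<psi> e then 1 else 0)" if "e \<in> E" for e
    using PiE_mem[OF assms(3) that] assms(2) by (simp add: power_nf_coeff_def)
  show ?thesis
  proof (cases "conformal p E \<psi> \<phi>")
    case True
    then have "monomial_nf_coeff p E \<phi> \<psi> = (\<Prod>e\<in>E. if \<phi> e = p - 1 then - 1 else 1)"
      unfolding monomial_nf_coeff_def by (intro prod.cong) (auto simp: coeff conformal_def)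
    also have "\<dots> = (- 1) ^ card {e \<in> E. \<phi> e = p - 1}"
      using assms(1) by (simp add: prod.If_cases Int_def)
    finally show ?thesis using True by (simp add: even_map_def)
  next
    case False
    then show ?thesis
      using assms(1) by (auto simp: monomial_nf_coeff_def coeff conformal_def prod_zero_iff)
  qed
qed

lemma sum_monomial_nf_coeff_dual_flows:
  assumes "finite (arcs G)" and "p > 0"
  shows "(\<Sum>\<phi> | dual_flow p G \<phi>. monomial_nf_coeff p (arcs G) \<phi> \<psi>) =
    of_int (conformal_excess p G \<psi>)"
proof -
  let ?D = "{\<phi>. dual_flow p G \<phi>}" and ?E = "arcs G"
  have "(\<Sum>\<phi>\<in>?D. monomial_nf_coeff p ?E \<phi> \<psi>) =
      (\<Sum>\<phi>\<in>?D. (if conformal p ?E \<psi> \<phi> \<and> even_map p ?E \<phi> then 1 else 0) -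
        (if conformal p ?E \<psi> \<phi> \<and> \<not> even_map p ?E \<phi> then 1 else 0))"
    using assms by (intro sum.cong) (auto simp: monomial_nf_coeff_conformal dual_flow_def)
  then show ?thesis
    using finite_dual_flows[OF assms(1), of p]
    by (simp add: sum_subtractf sum.If_cases conformal_excess_def Int_def)
qed

lemma (in fin_digraph) nf_coeff_flow_poly:
  assumes "Digraph_Component.connected G" and "p > 0"
  shows "nf_coeff p (arcs G) (flow_poly p G) \<psi> = of_nat p * of_int (conformal_excess p G \<psi>)"
proof -
  let ?Y = "verts G \<rightarrow>\<^sub>E {0..p-1}"
  have "nf_coeff p (arcs G) (flow_poly p G) \<psi> = (\<Sum>y\<in>?Y.
      monomial_nf_coeff p (arcs G) (\<lambda>e. y (head G e) + (p - 1) * y (tail G e)) \<psi>)"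
    using nf_coeff_power_product[of "arcs G" p 1] by (simp add: flow_poly_expand nf_coeff_sum)
  also have "\<dots> = (\<Sum>y\<in>?Y. monomial_nf_coeff p (arcs G) (coboundary p G y) \<psi>)"
    using assms(2)
    by (intro sum.cong monomial_nf_coeff_cong_mod) (simp_all add: coboundary_eq_mod cong_def)
  also have "\<dots> = of_nat p * (\<Sum>\<phi> | dual_flow p G \<phi>. monomial_nf_coeff p (arcs G) \<phi> \<psi>)"
    using assms by (rule sum_coboundary)
  also have "\<dots> = of_nat p * of_int (conformal_excess p G \<psi>)"
    using assms(2) by (simp add: sum_monomial_nf_coeff_dual_flows)
  finally show ?thesis .
qed

theorem theorem3p3:
  fixes G :: "('v, 'e) pre_digraph" and p :: nat
  assumes "fin_digraph G"
    and "Digraph_Component.connected G"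
    and "p \<ge> 2"
  shows "normal_form p (arcs G) (flow_poly p G) =
    of_nat p * (\<Sum>\<psi>\<in>basic_exponents p (arcs G).
      of_int (conformal_excess p G \<psi>) * power_product (arcs G) \<psi>)"
proof -
  interpret fin_digraph G by fact
  have "flow_poly p G \<in> polys_in (arcs G)"
    unfolding flow_poly_expand by (intro polys_in_sum polys_in_power_product)
  then have "normal_form p (arcs G) (flow_poly p G) =
      basic_combination p (arcs G) (nf_coeff p (arcs G) (flow_poly p G))"
    using assms(3) by (intro normal_form_eq) auto
  also have "\<dots> = basic_combination p (arcs G) (\<lambda>\<psi>. of_nat p * of_int (conformal_excess p G \<psi>))"
    using assms(2,3) by (intro basic_combination_cong nf_coeff_flow_poly) auto
  also have "\<dots> = of_nat p * (\<Sum>\<psi>\<in>basic_exponents p (arcs G).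
      of_int (conformal_excess p G \<psi>) * power_product (arcs G) \<psi>)"
    by (simp add: basic_combination_def pconst_mult pconst_of_nat pconst_of_int sum_distrib_left
        mult.assoc)
  finally show ?thesis .
qed

end
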